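(* Let $n\ge5$ be an integer such that $n-1$ is not divisible by $3$. Then every spanning subgraph $G\subseteq K_n^+\subseteq\overline{\mathcal K}_n^{(1)}$ which is isomorphic (as a graph) to $(CH)^{(1)}$ for some Hamiltonian graph $H$ is a bypassing subgraph in $\overline{\mathcal K}_n$ and is $1$-ic-colorable in $\overline{\mathcal K}_n$.
   Context: The simplicial poset $\overline{\mathcal K}_n$: a minimum $\hat0$; vertices $v_1,\dots,v_n$; edges $e_{ij}=e_{ji}$ and $e^i_j=e^j_i$ for each pair $i\ne j$, both with endpoints $v_i,v_j$; triangles $\Delta_{ijk}$ (one for each $3$-subset $\{i,j,k\}$) with facets $e_{ij},e_{jk},e_{ik}$, and triangles $\Delta^i_{jk}=\Delta^i_{kj}$ (pairwise distinct $i,j,k$) with facets $e^i_j,e^i_k,e_{jk}$; the order is generated by these face relations. $\overline{\mathcal K}_n^{(1)}$ is its $1$-skeleton graph (vertices $v_i$, edges all $e_{ij},e^i_j$), and $K_n^+$ is the subgraph with all vertices and the edges $e^i_j$ (a copy of the complete graph $K_n$). A spanning subgraph contains all $n$ vertices. For a graph $H$, $(CH)^{(1)}$ is the graph obtained from $H$ by adding one new vertex joined by one edge to each vertex of $H$. A graph is Hamiltonian if it has a cycle passing through every vertex exactly once. A walk in $\overline{\mathcal K}_n$ is a sequence of edges $e_1,\dots,e_m$ with vertices $w_1,\dots,w_{m+1}$, $e_i$ having endpoints $w_i,w_{i+1}$; its length is $m$. A cycle is a walk with no repeated edge whose first and last vertices coincide. An elementary contraction replaces two consecutive edges $e_i,e_{i+1}$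 by an edge $\tilde e$ such that $e_i,e_{i+1},\tilde e$ are the three facets of a triangle; a walk can be contracted to $q$ if $q$ results from finitely many (possibly zero) elementary contractions. A subgraph $G$ of the $1$-skeleton is bypassing in $\overline{\mathcal K}_n$ if it contains all vertices and each edge $e$ of $\overline{\mathcal K}_n$ admits a walk in $G$ contractable to the one-edge walk $e$. $B_G(e)$ is the set of shortest walks in $G$ contractable to $e$. An isometric even cycle in $G$ (with respect to $\overline{\mathcal K}_n$) is a cycle in $G$ with edges $e_1,\dots,e_{2m}$ and vertices $w_1,\dots,w_{2m}$ ($e_i$ joining $w_i,w_{i+1}$, indices mod $2m$) such that for every $1\le i\le m$ there is an edge $\tilde e_i$ of $\overline{\mathcal K}_n$ not in $G$ joining $w_i$ and $w_{i+m}$ for which both walks $e_i,\dots,e_{i+m-1}$ and $e_{i+m},\dots,e_{i+2m-1}$ lie in $B_G(\tilde e_i)$; the edges $e_i$ and $e_{i+m}$ are called opposite. Let $\sim$ be the smallest equivalence relation on $E(G)$ with $e\sim e'$ whenever $e,e'$ are opposite edges of some isometric even cycle in $G$. $G$ is $1$-ic-colorable in $\overline{\mathcal K}_n$ if $\sim$ has exactly one equivalence class. *)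

theory Defs
  imports Main
begin

record ('v, 'e) mgraph =
  verts :: "'v set"
  edges :: "'e set"
  ends :: "'e \<Rightarrow> 'v set"

definition graph :: "('v, 'e) mgraph \<Rightarrow> bool" where
  "graph G \<longleftrightarrow> (\<forall>e\<in>edges G. ends G e \<subseteq> verts G \<and> card (ends G e) = 2)"

text \<open>The value of \<open>ends G\<close> is irrelevant outside \<open>edges G\<close>.\<close>

definition subgraph :: "('v, 'e) mgraph \<Rightarrow> ('v, 'e) mgraph \<Rightarrow> bool" where
  "subgraph G K \<longleftrightarrow> graph G \<and> graph K \<and> verts G \<subseteq> verts K \<and> edges G \<subseteq> edges K \<and>
     (\<forall>e\<in>edges G. ends G e = ends K e)"

definition spanning_subgraph :: "('v, 'e) mgraph \<Rightarrow> ('v, 'e) mgraph \<Rightarrow> bool" where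
  "spanning_subgraph G K \<longleftrightarrow> subgraph G K \<and> verts G = verts K"

definition graph_iso :: "('v, 'e) mgraph \<Rightarrow> ('w, 'f) mgraph \<Rightarrow> bool" where
  "graph_iso G K \<longleftrightarrow> (\<exists>\<phi> \<psi>. bij_betw \<phi> (verts G) (verts K) \<and> bij_betw \<psi> (edges G) (edges K) \<and>
     (\<forall>e\<in>edges G. ends K (\<psi> e) = \<phi> ` ends G e))"

text \<open>The graph \<open>(CH)\<^sup>(\<^sup>1\<^sup>)\<close>: \<open>None\<close> is the apex, and \<open>Inr v\<close> is the edge from the apex to \<open>v\<close>.\<close>

definition cone :: "('v, 'e) mgraph \<Rightarrow> ('v option, 'e + 'v) mgraph" where
  "cone H = \<lparr> verts = insert None (Some ` verts H),
              edges = Inl ` edges H \<union> Inr ` verts H,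
              ends = (\<lambda>x. case x of Inl e \<Rightarrow> Some ` ends H e | Inr v \<Rightarrow> {None, Some v}) \<rparr>"

text \<open>A walk is a pair of its vertex list \<open>w\<^sub>1, \<dots>, w\<^sub>m\<^sub>+\<^sub>1\<close> and its edge list \<open>e\<^sub>1, \<dots>, e\<^sub>m\<close>;
  in the presence of parallel edges neither list determines the other.\<close>

type_synonym ('v, 'e) walk = "'v list \<times> 'e list"

definition is_walk :: "('v, 'e) mgraph \<Rightarrow> ('v, 'e) walk \<Rightarrow> bool" where
  "is_walk G = (\<lambda>(ws, es). length ws = Suc (length es) \<and> set ws \<subseteq> verts G \<and> set es \<subseteq> edges G \<and>
     (\<forall>i<length es. ends G (es ! i) = {ws ! i, ws ! Suc i}))"

definition walk_length :: "('v, 'e) walk \<Rightarrow> nat" where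
  "walk_length w = length (snd w)"

definition is_cycle :: "('v, 'e) mgraph \<Rightarrow> ('v, 'e) walk \<Rightarrow> bool" where
  "is_cycle G = (\<lambda>(ws, es). is_walk G (ws, es) \<and> es \<noteq> [] \<and> distinct es \<and> hd ws = last ws)"

definition hamiltonian :: "('v, 'e) mgraph \<Rightarrow> bool" where
  "hamiltonian G \<longleftrightarrow>
     (\<exists>ws es. is_cycle G (ws, es) \<and> distinct (tl ws) \<and> set (tl ws) = verts G)"

text \<open>\<open>Edge {i, j}\<close> is \<open>e\<^sub>i\<^sub>j\<close>, \<open>EdgeP {i, j}\<close> is \<open>e\<^sup>i\<^sub>j = e\<^sup>j\<^sub>i\<close>, \<open>Tri {i, j, k}\<close> is \<open>\<Delta>\<^sub>i\<^sub>j\<^sub>k\<close>,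
  and \<open>TriP i {j, k}\<close> is \<open>\<Delta>\<^sup>i\<^sub>j\<^sub>k\<close>.\<close>

datatype cell = Zero | Vert nat | Edge "nat set" | EdgeP "nat set" | Tri "nat set" | TriP nat "nat set"

definition Kvertices :: "nat \<Rightarrow> cell set" where
  "Kvertices n = {Vert i | i. i \<in> {1..n}}"

definition Kedges_plain :: "nat \<Rightarrow> cell set" where
  "Kedges_plain n = {Edge {i, j} | i j. i \<in> {1..n} \<and> j \<in> {1..n} \<and> i \<noteq> j}"

definition Kedges_plus :: "nat \<Rightarrow> cell set" where
  "Kedges_plus n = {EdgeP {i, j} | i j. i \<in> {1..n} \<and> j \<in> {1..n} \<and> i \<noteq> j}"

definition Ktriangles :: "nat \<Rightarrow> cell set" where
  "Ktriangles n =
     {Tri {i, j, k} | i j k. {i, j, k} \<subseteq> {1..n} \<and> distinct [i, j, k]} \<union>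
     {TriP i {j, k} | i j k. {i, j, k} \<subseteq> {1..n} \<and> distinct [i, j, k]}"

definition Kbar :: "nat \<Rightarrow> cell set" where
  "Kbar n = {Zero} \<union> Kvertices n \<union> Kedges_plain n \<union> Kedges_plus n \<union> Ktriangles n"

text \<open>The generating face relations. Since the indices of a rule may be permuted, each rule yields
  all facets of the kind shown.\<close>

inductive facet :: "cell \<Rightarrow> cell \<Rightarrow> bool" where
  "facet Zero (Vert i)"
| "i \<noteq> j \<Longrightarrow> facet (Vert i) (Edge {i, j})"
| "i \<noteq> j \<Longrightarrow> facet (Vert i) (EdgeP {i, j})"
| "distinct [i, j, k] \<Longrightarrow> facet (Edge {i, j}) (Tri {i, j, k})"
| "distinct [i, j, k] \<Longrightarrow> facet (EdgeP {i, j}) (TriP i {j, k})"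
| "distinct [i, j, k] \<Longrightarrow> facet (Edge {j, k}) (TriP i {j, k})"

definition Kle :: "nat \<Rightarrow> cell \<Rightarrow> cell \<Rightarrow> bool" where
  "Kle n x y \<longleftrightarrow> x \<in> Kbar n \<and> y \<in> Kbar n \<and> facet\<^sup>*\<^sup>* x y"

definition Kfacets :: "nat \<Rightarrow> cell \<Rightarrow> cell set" where
  "Kfacets n t = {x \<in> Kbar n. facet x t}"

definition skeleton :: "nat \<Rightarrow> (cell, cell) mgraph" where
  "skeleton n = \<lparr> verts = Kvertices n,
                  edges = Kedges_plain n \<union> Kedges_plus n,
                  ends = (\<lambda>e. {v \<in> Kvertices n. Kle n v e}) \<rparr>"

definition Kplus :: "nat \<Rightarrow> (cell, cell) mgraph" where
  "Kplus n = (skeleton n) \<lparr> edges := Kedges_plus n \<rparr>"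

text \<open>The lists \<open>us\<close> and \<open>es\<close> have equal length, so that \<open>e\<close> and \<open>f\<close> are the edges from \<open>a\<close> to \<open>b\<close>
  and from \<open>b\<close> to \<open>c\<close>. As a triangle has three distinct facets, \<open>e\<close>, \<open>f\<close>, \<open>g\<close> are distinct.\<close>

inductive elem_contraction :: "nat \<Rightarrow> (cell, cell) walk \<Rightarrow> (cell, cell) walk \<Rightarrow> bool" for n where
  "\<lbrakk> length us = length es; t \<in> Ktriangles n; Kfacets n t = {e, f, g} \<rbrakk> \<Longrightarrow>
   elem_contraction n (us @ [a, b, c] @ vs, es @ [e, f] @ fs) (us @ [a, c] @ vs, es @ [g] @ fs)"

definition contractable_to_edge :: "nat \<Rightarrow> (cell, cell) walk \<Rightarrow> cell \<Rightarrow> bool" where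
  "contractable_to_edge n w e \<longleftrightarrow> (\<exists>q. is_walk (skeleton n) q \<and> snd q = [e] \<and> (elem_contraction n)\<^sup>*\<^sup>* w q)"

definition bypassing :: "nat \<Rightarrow> (cell, cell) mgraph \<Rightarrow> bool" where
  "bypassing n G \<longleftrightarrow> spanning_subgraph G (skeleton n) \<and>
     (\<forall>e\<in>edges (skeleton n). \<exists>w. is_walk G w \<and> contractable_to_edge n w e)"

definition shortest_bypasses :: "nat \<Rightarrow> (cell, cell) mgraph \<Rightarrow> cell \<Rightarrow> (cell, cell) walk set" where
  "shortest_bypasses n G e =
     {w. is_walk G w \<and> contractable_to_edge n w e \<and>
         (\<forall>w'. is_walk G w' \<and> contractable_to_edge n w' e \<longrightarrow> walk_length w \<le> walk_length w')}"

text \<open>The part of length \<open>m\<close> starting at position \<open>i\<close> of a closed walk of length \<open>2m\<close>; positions are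
  counted from \<open>0\<close>.\<close>

definition half_cycle :: "nat \<Rightarrow> ('v, 'e) walk \<Rightarrow> nat \<Rightarrow> ('v, 'e) walk" where
  "half_cycle m = (\<lambda>(ws, es) i. (map (\<lambda>k. ws ! ((i + k) mod (2 * m))) [0..<Suc m],
                              map (\<lambda>k. es ! ((i + k) mod (2 * m))) [0..<m]))"

definition isometric_even_cycle ::
    "nat \<Rightarrow> (cell, cell) mgraph \<Rightarrow> nat \<Rightarrow> (cell, cell) walk \<Rightarrow> bool" where
  "isometric_even_cycle n G m = (\<lambda>(ws, es). is_cycle G (ws, es) \<and> length es = 2 * m \<and>
     (\<forall>i<m. \<exists>e \<in> edges (skeleton n) - edges G.
        ends (skeleton n) e = {ws ! i, ws ! (i + m)} \<and>
        half_cycle m (ws, es) i \<in> shortest_bypasses n G e \<and>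
        half_cycle m (ws, es) (i + m) \<in> shortest_bypasses n G e))"

definition opposite_edges :: "nat \<Rightarrow> (cell, cell) mgraph \<Rightarrow> (cell \<times> cell) set" where
  "opposite_edges n G = {(es ! i, es ! (i + m)) | ws es m i.
     isometric_even_cycle n G m (ws, es) \<and> i < m}"

definition ic_equiv :: "nat \<Rightarrow> (cell, cell) mgraph \<Rightarrow> (cell \<times> cell) set" where
  "ic_equiv n G = \<Inter> {r. equiv (edges G) r \<and> opposite_edges n G \<subseteq> r}"

definition one_ic_colorable :: "nat \<Rightarrow> (cell, cell) mgraph \<Rightarrow> bool" where
  "one_ic_colorable n G \<longleftrightarrow> card (edges G // ic_equiv n G) = 1"

inductive_cases facet_VertE: "facet x (Vert i)"
inductive_cases facet_ZeroE: "facet x Zero"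

lemma facet_Edge_iff: "i \<noteq> j \<Longrightarrow> facet x (Edge {i, j}) \<longleftrightarrow> x = Vert i \<or> x = Vert j"
  by (auto simp: facet.simps doubleton_eq_iff)

lemma facet_EdgeP_iff: "i \<noteq> j \<Longrightarrow> facet x (EdgeP {i, j}) \<longleftrightarrow> x = Vert i \<or> x = Vert j"
  by (auto simp: facet.simps doubleton_eq_iff)

lemma facet_Tri_iff:
  assumes "distinct [i, j, k]"
  shows "facet x (Tri {i, j, k}) \<longleftrightarrow> x = Edge {i, j} \<or> x = Edge {j, k} \<or> x = Edge {i, k}"
proof
  assume "facet x (Tri {i, j, k})"
  then obtain a b c where abc: "x = Edge {a, b}" "{i, j, k} = {a, b, c}" "distinct [a, b, c]"
    by (auto simp: facet.simps)
  then have "a \<in> {i, j, k}" "b \<in> {i, j, k}" "a \<noteq> b" by auto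
  with abc(1) show "x = Edge {i, j} \<or> x = Edge {j, k} \<or> x = Edge {i, k}"
    by (auto simp: doubleton_eq_iff)
next
  have "{i, j, k} = {j, k, i}" "{i, j, k} = {i, k, j}" by auto
  then show "x = Edge {i, j} \<or> x = Edge {j, k} \<or> x = Edge {i, k} \<Longrightarrow> facet x (Tri {i, j, k})"
    using assms facet.intros(4)[of i j k] facet.intros(4)[of j k i] facet.intros(4)[of i k j] by auto
qed

lemma facet_TriP_iff:
  assumes "distinct [i, j, k]"
  shows "facet x (TriP i {j, k}) \<longleftrightarrow> x = EdgeP {i, j} \<or> x = EdgeP {i, k} \<or> x = Edge {j, k}"
proof
  assume "facet x (TriP i {j, k})"
  then obtain a b where "{j, k} = {a, b}" "x = EdgeP {i, a} \<or> x = Edge {a, b}"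
    by cases blast+
  then show "x = EdgeP {i, j} \<or> x = EdgeP {i, k} \<or> x = Edge {j, k}"
    by (metis doubleton_eq_iff)
next
  have "facet (EdgeP {i, j}) (TriP i {j, k})" "facet (EdgeP {i, k}) (TriP i {j, k})"
      "facet (Edge {j, k}) (TriP i {j, k})"
    using assms facet.intros(5)[of i j k] facet.intros(5)[of i k j] facet.intros(6)[of i j k]
    by (simp_all add: insert_commute)
  then show "x = EdgeP {i, j} \<or> x = EdgeP {i, k} \<or> x = Edge {j, k} \<Longrightarrow> facet x (TriP i {j, k})"
    by blast
qed

lemma Kbar_memI:
  "i \<in> {1..n} \<Longrightarrow> Vert i \<in> Kbar n"
  "\<lbrakk> i \<in> {1..n}; j \<in> {1..n}; i \<noteq> j \<rbrakk> \<Longrightarrow> Edge {i, j} \<in> Kbar n"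
  "\<lbrakk> i \<in> {1..n}; j \<in> {1..n}; i \<noteq> j \<rbrakk> \<Longrightarrow> EdgeP {i, j} \<in> Kbar n"
  unfolding Kbar_def Kvertices_def Kedges_plain_def Kedges_plus_def by blast+

lemma Kfacets_Tri:
  assumes "{i, j, k} \<subseteq> {1..n}" "distinct [i, j, k]"
  shows "Kfacets n (Tri {i, j, k}) = {Edge {i, j}, Edge {j, k}, Edge {i, k}}"
proof -
  have "Edge {i, j} \<in> Kbar n" "Edge {j, k} \<in> Kbar n" "Edge {i, k} \<in> Kbar n"
    using assms by (simp_all add: Kbar_memI)
  then show ?thesis
    unfolding Kfacets_def facet_Tri_iff[OF assms(2)] by blast
qed

lemma Kfacets_TriP:
  assumes "{i, j, k} \<subseteq> {1..n}" "distinct [i, j, k]"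
  shows "Kfacets n (TriP i {j, k}) = {EdgeP {i, j}, EdgeP {i, k}, Edge {j, k}}"
proof -
  have "EdgeP {i, j} \<in> Kbar n" "EdgeP {i, k} \<in> Kbar n" "Edge {j, k} \<in> Kbar n"
    using assms by (simp_all add: Kbar_memI)
  then show ?thesis
    unfolding Kfacets_def facet_TriP_iff[OF assms(2)] by blast
qed

lemma facet_rtrancl_Vert_Vert: "facet\<^sup>*\<^sup>* (Vert i) (Vert j) \<longleftrightarrow> i = j"
proof
  assume "facet\<^sup>*\<^sup>* (Vert i) (Vert j)"
  then show "i = j"
  proof (cases rule: rtranclp.cases)
    case (rtrancl_into_rtrancl y)
    then have "facet\<^sup>*\<^sup>* (Vert i) Zero" by (auto elim: facet_VertE)
    then show ?thesis by (cases rule: rtranclp.cases) (auto elim: facet_ZeroE)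
  qed simp
qed simp

lemma facet_rtrancl_Vert_Edge:
  "i \<noteq> j \<Longrightarrow> facet\<^sup>*\<^sup>* (Vert a) (Edge {i, j}) \<longleftrightarrow> a = i \<or> a = j"
  by (subst rtranclp.simps) (auto simp: facet_Edge_iff facet_rtrancl_Vert_Vert)

lemma facet_rtrancl_Vert_EdgeP:
  "i \<noteq> j \<Longrightarrow> facet\<^sup>*\<^sup>* (Vert a) (EdgeP {i, j}) \<longleftrightarrow> a = i \<or> a = j"
  by (subst rtranclp.simps) (auto simp: facet_EdgeP_iff facet_rtrancl_Vert_Vert)

lemma ends_skeleton_Edge:
  assumes "i \<in> {1..n}" "j \<in> {1..n}" "i \<noteq> j"
  shows "ends (skeleton n) (Edge {i, j}) = {Vert i, Vert j}"
proof -
  have "Edge {i, j} \<in> Kbar n" "Vert i \<in> Kbar n" "Vert j \<in> Kbar n"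
    using assms by (simp_all add: Kbar_memI)
  with assms show ?thesis
    by (auto simp: skeleton_def Kle_def facet_rtrancl_Vert_Edge Kvertices_def)
qed

lemma ends_skeleton_EdgeP:
  assumes "i \<in> {1..n}" "j \<in> {1..n}" "i \<noteq> j"
  shows "ends (skeleton n) (EdgeP {i, j}) = {Vert i, Vert j}"
proof -
  have "EdgeP {i, j} \<in> Kbar n" "Vert i \<in> Kbar n" "Vert j \<in> Kbar n"
    using assms by (simp_all add: Kbar_memI)
  with assms show ?thesis
    by (auto simp: skeleton_def Kle_def facet_rtrancl_Vert_EdgeP Kvertices_def)
qed

lemma graph_skeleton: "graph (skeleton n)"
proof -
  have "ends (skeleton n) e \<subseteq> verts (skeleton n) \<and> card (ends (skeleton n) e) = 2"
    if "e \<in> edges (skeleton n)" for e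
  proof -
    from that obtain i j where "i \<in> {1..n}" "j \<in> {1..n}" "i \<noteq> j" "e = Edge {i, j} \<or> e = EdgeP {i, j}"
      by (auto simp: skeleton_def Kedges_plain_def Kedges_plus_def)
    then have "ends (skeleton n) e = {Vert i, Vert j}" "Vert i \<in> verts (skeleton n)"
        "Vert j \<in> verts (skeleton n)" "Vert i \<noteq> Vert j"
      using ends_skeleton_Edge[of i n j] ends_skeleton_EdgeP[of i n j]
      by (auto simp: skeleton_def Kvertices_def)
    then show ?thesis by simp
  qed
  then show ?thesis by (simp add: graph_def)
qed

lemma spanning_subgraph_Kplus: "spanning_subgraph (Kplus n) (skeleton n)"
  using graph_skeleton[of n]
  by (auto simp: spanning_subgraph_def subgraph_def graph_def Kplus_def skeleton_def)

end

theory Submission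
  imports Defs
begin

text \<open>
  A path of length 2 in \<open>K\<^sub>n\<^sup>+\<close> contracts to the \<open>Edge\<close> between its ends, which is never in \<open>G\<close>;
  hence every 4-cycle of \<open>G\<close> is an isometric even cycle. A path of length 3 contracts to the \<open>EdgeP\<close>
  between its ends, and in a cone over a Hamiltonian graph there are enough paths of both kinds.
  Let \<open>a\<close> be the apex and \<open>h\<^sub>0, \<dots>, h\<^sub>k\<^sub>-\<^sub>1\<close>, \<open>k = n - 1\<close>, the Hamiltonian cycle of the base.
  A path \<open>x, y, z\<close> in the base gives the 4-cycle \<open>a, x, y, z\<close>, whence \<open>ax \<sim> yz\<close> and \<open>xy \<sim> az\<close>.
  So \<open>ah\<^sub>i \<sim> h\<^sub>i\<^sub>+\<^sub>1h\<^sub>i\<^sub>+\<^sub>2 \<sim> ah\<^sub>i\<^sub>+\<^sub>3\<close>, which identifies all edges at the apex since 3 does not divide \<open>k\<close>,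
  and every edge of the base is equivalent to one of them.
\<close>

section \<open>Elementary contractions and contractions of short paths\<close>

lemma elem_contraction_length:
  "elem_contraction n w w' \<Longrightarrow> length (snd w) = Suc (length (snd w')) \<and> snd w' \<noteq> []"
  by (auto elim: elem_contraction.cases)

lemma elem_contractions_length:
  "(elem_contraction n)\<^sup>*\<^sup>* w q \<Longrightarrow> w = q \<or> length (snd q) < length (snd w)"
  by (induction rule: rtranclp_induct) (auto dest: elem_contraction_length)

text \<open>A walk in \<open>G\<close> differs from any one-edge walk along \<open>e\<close>, so at
  least one contraction takes place, and each contraction costs one edge. This is the lower bound
  behind minimality of bypasses.\<close>

lemma contractable_length_ge_2:
  assumes "is_walk G w" "contractable_to_edge n w e" "e \<notin> edges G"
  shows "2 \<le> walk_length w"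
proof -
  obtain q where q: "snd q = [e]" "(elem_contraction n)\<^sup>*\<^sup>* w q"
    using assms(2) by (auto simp: contractable_to_edge_def)
  have "w \<noteq> q"
    using assms(1,3) q(1) by (auto simp: is_walk_def)
  then show ?thesis
    using elem_contractions_length[OF q(2)] q(1) by (auto simp: walk_length_def)
qed

lemma skeleton_simps:
  "verts (skeleton n) = Kvertices n"
  "edges (skeleton n) = Kedges_plain n \<union> Kedges_plus n"
  by (simp_all add: skeleton_def)

text \<open>The triangle \<open>TriP y {x, z}\<close> has the two edges of the path and the plain
  edge opposite to \<open>y\<close> as facets.\<close>

lemma contractable_path2:
  assumes "{x, y, z} \<subseteq> {1..n}" "distinct [x, y, z]"
  shows "contractable_to_edge n ([Vert x, Vert y, Vert z], [EdgeP {x, y}, EdgeP {y, z}]) (Edge {x, z})"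
proof -
  have "TriP y {x, z} \<in> Ktriangles n"
    using assms unfolding Ktriangles_def by fastforce
  moreover have "Kfacets n (TriP y {x, z}) = {EdgeP {x, y}, EdgeP {y, z}, Edge {x, z}}"
    using Kfacets_TriP[of y x z n] assms by (auto simp: insert_commute)
  ultimately have "elem_contraction n ([Vert x, Vert y, Vert z], [EdgeP {x, y}, EdgeP {y, z}])
      ([Vert x, Vert z], [Edge {x, z}])"
    using elem_contraction.intros[of "[]" "[]" _ n _ _ _ "Vert x" "Vert y" "Vert z" "[]" "[]"] by auto
  moreover have "is_walk (skeleton n) ([Vert x, Vert z], [Edge {x, z}])"
    using assms ends_skeleton_Edge[of x n z]
    by (auto simp: is_walk_def skeleton_simps Kvertices_def Kedges_plain_def)
  ultimately show ?thesis
    unfolding contractable_to_edge_def by fastforce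
qed

text \<open>Two contractions suffice: across \<open>TriP y {x, z}\<close> to the plain edge
  \<open>Edge {x, z}\<close>, then across \<open>TriP u {x, z}\<close> back to an
  \<open>EdgeP\<close>.\<close>

lemma contractable_path3:
  assumes "{x, y, z, u} \<subseteq> {1..n}" "distinct [x, y, z, u]"
  shows "contractable_to_edge n
    ([Vert x, Vert y, Vert z, Vert u], [EdgeP {x, y}, EdgeP {y, z}, EdgeP {z, u}]) (EdgeP {x, u})"
proof -
  have "TriP y {x, z} \<in> Ktriangles n" "TriP u {x, z} \<in> Ktriangles n"
    using assms unfolding Ktriangles_def by fastforce+
  moreover have "Kfacets n (TriP y {x, z}) = {EdgeP {x, y}, EdgeP {y, z}, Edge {x, z}}"
    "Kfacets n (TriP u {x, z}) = {Edge {x, z}, EdgeP {z, u}, EdgeP {x, u}}"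
    using Kfacets_TriP[of y x z n] Kfacets_TriP[of u x z n] assms by (auto simp: insert_commute)
  ultimately have
    "elem_contraction n
      ([Vert x, Vert y, Vert z, Vert u], [EdgeP {x, y}, EdgeP {y, z}, EdgeP {z, u}])
      ([Vert x, Vert z, Vert u], [Edge {x, z}, EdgeP {z, u}])"
    "elem_contraction n ([Vert x, Vert z, Vert u], [Edge {x, z}, EdgeP {z, u}])
      ([Vert x, Vert u], [EdgeP {x, u}])"
    using elem_contraction.intros[of "[]" "[]" _ n _ _ _ "Vert x" "Vert y" "Vert z" "[Vert u]" "[EdgeP {z, u}]"]
      elem_contraction.intros[of "[]" "[]" _ n _ _ _ "Vert x" "Vert z" "Vert u" "[]" "[]"] by auto
  then have "(elem_contraction n)\<^sup>*\<^sup>*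
      ([Vert x, Vert y, Vert z, Vert u], [EdgeP {x, y}, EdgeP {y, z}, EdgeP {z, u}])
      ([Vert x, Vert u], [EdgeP {x, u}])"
    by (meson converse_rtranclp_into_rtranclp r_into_rtranclp)
  moreover have "is_walk (skeleton n) ([Vert x, Vert u], [EdgeP {x, u}])"
    using assms ends_skeleton_EdgeP[of x n u]
    by (auto simp: is_walk_def skeleton_simps Kvertices_def Kedges_plus_def)
  ultimately show ?thesis
    unfolding contractable_to_edge_def by fastforce
qed

section \<open>Paths, four-cycles and edge classes in spanning subgraphs of
  \<open>K_n^+\<close>\<close>

locale Kplus_subgraph =
  fixes n :: nat and G :: "(cell, cell) mgraph"
  assumes spanning: "spanning_subgraph G (Kplus n)"
begin

definition adj :: "nat \<Rightarrow> nat \<Rightarrow> bool" where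
  "adj i j \<longleftrightarrow> EdgeP {i, j} \<in> edges G"

lemma verts_G: "verts G = Kvertices n"
  using spanning by (simp add: spanning_subgraph_def Kplus_def skeleton_def)

lemma edges_G_subset: "edges G \<subseteq> Kedges_plus n"
  using spanning by (simp add: spanning_subgraph_def subgraph_def Kplus_def)

lemma Edge_notin_G: "Edge A \<notin> edges G"
  using edges_G_subset by (auto simp: Kedges_plus_def)

lemma edges_G_cases:
  assumes "e \<in> edges G"
  obtains i j where "e = EdgeP {i, j}" "i \<in> {1..n}" "j \<in> {1..n}" "i \<noteq> j" "adj i j"
  using assms edges_G_subset unfolding Kedges_plus_def adj_def by blast

lemma adj_sym: "adj i j \<longleftrightarrow> adj j i"
  by (simp add: adj_def insert_commute)

lemma adj_range: "adj i j \<Longrightarrow> i \<in> {1..n} \<and> j \<in> {1..n} \<and> i \<noteq> j"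
  using edges_G_subset by (fastforce simp: adj_def Kedges_plus_def doubleton_eq_iff)

lemma ends_G: "adj i j \<Longrightarrow> ends G (EdgeP {i, j}) = {Vert i, Vert j}"
  using spanning adj_range[of i j] ends_skeleton_EdgeP[of i n j]
  by (auto simp: spanning_subgraph_def subgraph_def Kplus_def adj_def)

lemma spanning_skeleton: "spanning_subgraph G (skeleton n)"
  using spanning spanning_subgraph_Kplus[of n]
  by (auto simp: spanning_subgraph_def subgraph_def)

lemma Vert_in_G: "adj i j \<Longrightarrow> Vert i \<in> verts G \<and> Vert j \<in> verts G"
  using adj_range by (auto simp: verts_G Kvertices_def)

lemma is_walk_path1: "adj x y \<Longrightarrow> is_walk G ([Vert x, Vert y], [EdgeP {x, y}])"
  using ends_G Vert_in_G by (auto simp: is_walk_def adj_def)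

lemma is_walk_path2:
  "adj x y \<Longrightarrow> adj y z \<Longrightarrow> is_walk G ([Vert x, Vert y, Vert z], [EdgeP {x, y}, EdgeP {y, z}])"
  using ends_G[of x y] ends_G[of y z] Vert_in_G[of x y] Vert_in_G[of y z]
  by (auto simp: is_walk_def adj_def less_Suc_eq)

lemma is_walk_path3:
  "adj x y \<Longrightarrow> adj y z \<Longrightarrow> adj z u \<Longrightarrow>
    is_walk G ([Vert x, Vert y, Vert z, Vert u], [EdgeP {x, y}, EdgeP {y, z}, EdgeP {z, u}])"
  using ends_G[of x y] ends_G[of y z] ends_G[of z u] Vert_in_G[of x y] Vert_in_G[of z u]
  by (auto simp: is_walk_def adj_def less_Suc_eq)

text \<open>Minimality comes from \<open>contractable_length_ge_2\<close>: \<open>G\<close> has no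
  plain edges, so every bypass of one has length at least 2.\<close>

lemma shortest_path2:
  assumes "adj x y" "adj y z" "x \<noteq> z"
  shows "([Vert x, Vert y, Vert z], [EdgeP {x, y}, EdgeP {y, z}]) \<in> shortest_bypasses n G (Edge {x, z})"
  using is_walk_path2[OF assms(1,2)] contractable_path2[of x y z n] assms
    adj_range[OF assms(1)] adj_range[OF assms(2)] contractable_length_ge_2[OF _ _ Edge_notin_G]
  by (auto simp: shortest_bypasses_def walk_length_def numeral_2_eq_2)

text \<open>The plain edges along the two diagonals serve as the edges outside \<open>G\<close>;
  each half of the cycle is a path of length 2, hence a shortest bypass of its diagonal.\<close>

lemma four_cycle_opposite:
  assumes adj: "adj x y" "adj y z" "adj z u" "adj u x" and ne: "x \<noteq> z" "y \<noteq> u"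
  shows "(EdgeP {x, y}, EdgeP {z, u}) \<in> opposite_edges n G"
proof -
  let ?ws = "[Vert x, Vert y, Vert z, Vert u, Vert x]"
  let ?es = "[EdgeP {x, y}, EdgeP {y, z}, EdgeP {z, u}, EdgeP {u, x}]"
  note r = adj[THEN adj_range]
  have "is_walk G (?ws, ?es)"
    unfolding is_walk_def
    using adj adj[THEN ends_G] adj[THEN Vert_in_G] by (simp add: adj_def All_less_Suc2)
  \<comment> \<open>Consecutive edges could coincide only if a diagonal collapsed, which
    \<open>ne\<close> excludes.\<close>
  moreover have "distinct ?es"
    using r ne by (simp add: doubleton_eq_iff)
  ultimately have "is_cycle G (?ws, ?es)"
    by (simp add: is_cycle_def)
  moreover have "\<exists>e \<in> edges (skeleton n) - edges G. ends (skeleton n) e = {?ws ! i, ?ws ! (i + 2)} \<and>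
        half_cycle 2 (?ws, ?es) i \<in> shortest_bypasses n G e \<and>
        half_cycle 2 (?ws, ?es) (i + 2) \<in> shortest_bypasses n G e" if "i < 2" for i
  proof -
    have diagonal: "Edge {p, q} \<in> edges (skeleton n) - edges G"
      "ends (skeleton n) (Edge {p, q}) = {Vert p, Vert q}"
      if "p \<in> {1..n}" "q \<in> {1..n}" "p \<noteq> q" for p q
      using that Edge_notin_G ends_skeleton_Edge[OF that]
      by (auto simp: skeleton_simps Kedges_plain_def)
    consider "i = 0" | "i = 1" using \<open>i < 2\<close> by linarith
    then show ?thesis
    proof cases
      case 1
      have "half_cycle 2 (?ws, ?es) 0 \<in> shortest_bypasses n G (Edge {x, z})"
        using shortest_path2[of x y z] adj ne by (simp add: half_cycle_def numeral_2_eq_2)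
      \<comment> \<open>The second half runs from \<open>z\<close> to \<open>x\<close>, but the
        plain edge is indexed by the unordered pair, so it bypasses the same edge.\<close>
      moreover have "half_cycle 2 (?ws, ?es) (0 + 2) \<in> shortest_bypasses n G (Edge {x, z})"
        using shortest_path2[of z u x] adj ne insert_commute[of x z "{}"]
        by (simp add: half_cycle_def numeral_2_eq_2)
      ultimately show ?thesis
        using diagonal[of x z] r ne 1 by (intro bexI[of _ "Edge {x, z}"]) simp_all
    next
      case 2
      have "half_cycle 2 (?ws, ?es) 1 \<in> shortest_bypasses n G (Edge {y, u})"
        using shortest_path2[of y z u] adj ne by (simp add: half_cycle_def numeral_2_eq_2)
      moreover have "half_cycle 2 (?ws, ?es) (1 + 2) \<in> shortest_bypasses n G (Edge {y, u})"
        using shortest_path2[of u x y] adj ne insert_commute[of y u "{}"]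
        by (simp add: half_cycle_def numeral_2_eq_2)
      ultimately show ?thesis
        using diagonal[of y u] r ne 2 by (intro bexI[of _ "Edge {y, u}"]) simp_all
    qed
  qed
  ultimately have "isometric_even_cycle n G 2 (?ws, ?es)"
    by (auto simp: isometric_even_cycle_def)
  then show ?thesis
    unfolding opposite_edges_def
    by (intro CollectI exI[of _ ?ws] exI[of _ ?es] exI[of _ 2] exI[of _ 0]) simp
qed

text \<open>Makes the total relation on \<open>edges G\<close> one of the relations intersected in
  \<open>ic_equiv\<close>.\<close>

lemma opposite_edges_subset: "opposite_edges n G \<subseteq> edges G \<times> edges G"
proof -
  have "es ! i \<in> edges G \<and> es ! (i + m) \<in> edges G"
    if "isometric_even_cycle n G m (ws, es)" "i < m" for ws es m i
  proof -
    have "set es \<subseteq> edges G" "i < length es" "i + m < length es"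
      using that by (auto simp: isometric_even_cycle_def is_cycle_def is_walk_def)
    then show ?thesis by (meson nth_mem subsetD)
  qed
  then show ?thesis by (fastforce simp: opposite_edges_def)
qed

lemma one_ic_colorable_if_all_equivalent:
  assumes "edges G \<noteq> {}"
    and all: "\<And>r. equiv (edges G) r \<Longrightarrow> opposite_edges n G \<subseteq> r \<Longrightarrow> edges G \<times> edges G \<subseteq> r"
  shows "one_ic_colorable n G"
proof -
  have eq: "equiv (edges G) (edges G \<times> edges G)"
    by (auto simp: equiv_def refl_on_def sym_def trans_def)
  have "ic_equiv n G = edges G \<times> edges G"
    unfolding ic_equiv_def using eq opposite_edges_subset all by blast
  then have "edges G // ic_equiv n G = {edges G}"
    using assms(1) by (auto simp: quotient_def)
  then show ?thesis by (simp add: one_ic_colorable_def)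
qed

end

section \<open>Cones over a Hamiltonian cycle, in coordinates\<close>

locale Kplus_cone = Kplus_subgraph +
  fixes a k :: nat and h :: "nat \<Rightarrow> nat"
  assumes k_ge: "4 \<le> k" and k_mod_3: "\<not> 3 dvd k"
    and base: "range h = {1..n} - {a}"
    \<comment> \<open>\<open>h\<close> lives on all naturals with period \<open>k\<close>, so
      positions on the cycle can be shifted without reducing them.\<close>
    and h_eq_iff: "h i = h j \<longleftrightarrow> i mod k = j mod k"
    and adj_apex: "adj a (h i)"
    and adj_cycle: "adj (h i) (h (Suc i))"
begin

lemma h_cases:
  assumes "x \<in> {1..n}" "x \<noteq> a" obtains i where "x = h (Suc i)"
proof -
  obtain j where "x = h j" using assms base by blast
  \<comment> \<open>Adding one period makes the index a successor, so that the preceding cycle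
    vertex can be named too.\<close>
  also have "h j = h (Suc (j + (k - 1)))" using k_ge by (simp add: h_eq_iff)
  finally show thesis using that by blast
qed

lemma h_ne: "h i \<noteq> h (i + 2)"
proof
  assume "h i = h (i + 2)"
  then have "k dvd 2" by (metis h_eq_iff mod_eq_dvd_iff_nat le_add1 add_diff_cancel_left')
  then show False using k_ge by (auto dest: dvd_imp_le)
qed

lemma h_ne_apex: "h i \<noteq> a" "a \<noteq> h i"
  using adj_range[OF adj_apex[of i]] by auto

text \<open>The predecessor and the successor of \<open>y\<close> on the cycle are distinct, so one
  of them avoids \<open>x\<close>.\<close>

lemma ex_neighbour:
  assumes "y \<in> {1..n}" "y \<noteq> a" shows "\<exists>z. adj y z \<and> z \<noteq> x \<and> z \<noteq> a"
proof -
  obtain i where i: "y = h (Suc i)" using h_cases[OF assms] .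
  have "adj y (h i)" "adj y (h (i + 2))"
    using adj_cycle[of i] adj_cycle[of "Suc i"] adj_sym by (simp_all add: i)
  then show ?thesis using h_ne[of i] h_ne_apex by metis
qed

lemma adj_apex': "x \<in> {1..n} \<Longrightarrow> x \<noteq> a \<Longrightarrow> adj a x"
  using h_cases adj_apex by metis

text \<open>The apex is a common neighbour of two base vertices; if one end is the apex, a base
  neighbour of the other end takes this role.\<close>

lemma bypass_plain:
  assumes "i \<in> {1..n}" "j \<in> {1..n}" "i \<noteq> j"
  shows "\<exists>w. is_walk G w \<and> contractable_to_edge n w (Edge {i, j})"
proof -
  have "\<exists>y. adj i y \<and> adj y j"
  proof (cases "i = a \<or> j = a")
    case True
    then show ?thesis
      using ex_neighbour[of i j] ex_neighbour[of j i] adj_apex' adj_sym adj_range assms by metis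
  next
    case False
    then show ?thesis using adj_apex' adj_sym assms by blast
  qed
  then obtain y where y: "adj i y" "adj y j" by blast
  then show ?thesis
    using shortest_path2[OF y assms(3)] by (auto simp: shortest_bypasses_def)
qed

lemma bypass_plus:
  assumes "i \<in> {1..n}" "j \<in> {1..n}" "i \<noteq> j"
  shows "\<exists>w. is_walk G w \<and> contractable_to_edge n w (EdgeP {i, j})"
proof (cases "adj i j")
  case True
  then have "is_walk G ([Vert i, Vert j], [EdgeP {i, j}])" by (rule is_walk_path1)
  moreover have "is_walk (skeleton n) ([Vert i, Vert j], [EdgeP {i, j}])"
    using assms ends_skeleton_EdgeP[OF assms]
    by (auto simp: is_walk_def skeleton_simps Kvertices_def Kedges_plus_def)
  ultimately show ?thesis by (fastforce simp: contractable_to_edge_def)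
next
  case False
  then have "i \<noteq> a" "j \<noteq> a" using adj_apex' adj_sym assms by blast+
  \<comment> \<open>The bypass will be \<open>i\<close>, \<open>a\<close>, \<open>y\<close>,
    \<open>j\<close>; \<open>y\<close> must avoid \<open>i\<close> and \<open>a\<close> because
    \<open>contractable_path3\<close> asks for four distinct vertices.\<close>
  moreover from this obtain y where y: "adj j y" "y \<noteq> i" "y \<noteq> a"
    using ex_neighbour[of j i] assms by blast
  ultimately have p: "adj i a" "adj a y" "adj y j" "distinct [i, a, y, j]"
    using adj_apex'[of i] adj_apex'[of y] adj_sym[of i a] adj_sym[of y j] adj_range[of j y] assms
    by auto
  have "{i, a, y, j} \<subseteq> {1..n}"
    using p(1,3)[THEN adj_range] by auto
  then show ?thesis
    using is_walk_path3[OF p(1-3)] contractable_path3[of i a y j n] p(4) by blast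
qed

lemma bypassing_G: "bypassing n G"
  unfolding bypassing_def
  using spanning_skeleton bypass_plain bypass_plus
  by (auto simp: skeleton_simps Kedges_plain_def Kedges_plus_def)

text \<open>The apex closes the path to a four-cycle \<open>a\<close>, \<open>x\<close>,
  \<open>y\<close>, \<open>z\<close>. Reading the path backwards gives the other pair of opposite
  edges.\<close>

lemma base_path_opposite:
  assumes "adj x y" "adj y z" "x \<noteq> z" "x \<noteq> a" "y \<noteq> a" "z \<noteq> a"
  shows "(EdgeP {a, x}, EdgeP {y, z}) \<in> opposite_edges n G"
  using four_cycle_opposite[of a x y z] assms adj_apex' adj_range adj_sym by metis

lemma all_equivalent:
  assumes eq: "equiv (edges G) r" and opp: "opposite_edges n G \<subseteq> r"
  shows "edges G \<times> edges G \<subseteq> r"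
proof -
  have refl: "(e, e) \<in> r" if "e \<in> edges G" for e
    using eq that by (auto simp: equiv_def refl_on_def)
  have sym: "(f, e) \<in> r" if "(e, f) \<in> r" for e f
    using eq that by (auto simp: equiv_def dest: symD)
  have trans: "(e, g) \<in> r" if "(e, f) \<in> r" "(f, g) \<in> r" for e f g
    using eq that by (auto simp: equiv_def dest: transD)
  let ?s = "\<lambda>i. EdgeP {a, h i}"
  have step: "(?s i, ?s (i + 3)) \<in> r" for i
  proof -
    have adj: "adj (h i) (h (i + 1))" "adj (h (i + 1)) (h (i + 2))" "adj (h (i + 2)) (h (i + 3))"
      using adj_cycle[of i] adj_cycle[of "i + 1"] adj_cycle[of "i + 2"]
      by (simp_all add: numeral_2_eq_2 numeral_3_eq_3)
    have ne: "h (i + 3) \<noteq> h (i + 1)"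
      using h_ne[of "i + 1"] by (simp add: numeral_3_eq_3)
    have "(?s i, EdgeP {h (i + 1), h (i + 2)}) \<in> r"
      using base_path_opposite[OF adj(1,2) h_ne h_ne_apex(1) h_ne_apex(1) h_ne_apex(1)] opp by blast
    \<comment> \<open>The same base edge is reached from the other side, by the path
      \<open>h (i + 3)\<close>, \<open>h (i + 2)\<close>, \<open>h (i + 1)\<close>.\<close>
    moreover have "(?s (i + 3), EdgeP {h (i + 2), h (i + 1)}) \<in> r"
      using base_path_opposite[OF adj(3)[unfolded adj_sym[of "h (i + 2)"]]
          adj(2)[unfolded adj_sym[of "h (i + 1)"]] ne h_ne_apex(1) h_ne_apex(1) h_ne_apex(1)] opp
      by blast
    ultimately show ?thesis
      using trans sym unfolding insert_commute[of "h (i + 2)" "h (i + 1)"] by blast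
  qed
  have multiples: "(?s 0, ?s (3 * j)) \<in> r" for j
  proof (induction j)
    case 0
    then show ?case using refl adj_apex[of 0] by (simp add: adj_def)
  next
    case (Suc j)
    then show ?case using step[of "3 * j"] trans by (simp add: add.commute)
  qed
  have spokes: "(?s 0, ?s i) \<in> r" for i
  proof -
    \<comment> \<open>Going around the cycle \<open>c\<close> more times keeps \<open>h i\<close>
      but makes the index a multiple of 3; \<open>c\<close> is \<open>2 * i\<close> or
      \<open>i\<close> according to \<open>k\<close> being 1 or 2 modulo 3.\<close>
    obtain c where "3 dvd i + c * k"
    proof (cases "k mod 3 = 1")
      case True
      then have "3 dvd 1 + 2 * k" by presburger
      then have "3 dvd i * (1 + 2 * k)" by (rule dvd_mult)
      then show thesis using that[of "2 * i"] by (simp add: algebra_simps)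
    next
      case False
      then have "3 dvd 1 + k" using k_mod_3 by presburger
      then have "3 dvd i * (1 + k)" by (rule dvd_mult)
      then show thesis using that[of i] by (simp add: algebra_simps)
    qed
    then obtain j where "i + c * k = 3 * j" by (auto simp: dvd_def)
    then have "h i = h (3 * j)" using mod_mult_self1[of i c k] by (simp add: h_eq_iff)
    then show ?thesis using multiples[of j] by simp
  qed
  have spokes': "(?s 0, EdgeP {a, x}) \<in> r" if "x \<in> {1..n}" "x \<noteq> a" for x
    using h_cases[OF that] spokes by metis
  have all: "(?s 0, e) \<in> r" if "e \<in> edges G" for e
  proof -
    obtain x y where e: "e = EdgeP {x, y}" "x \<in> {1..n}" "y \<in> {1..n}" "x \<noteq> y" "adj x y"
      using edges_G_cases[OF \<open>e \<in> edges G\<close>] .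
    show ?thesis
    proof (cases "x = a \<or> y = a")
      case True
      then show ?thesis
        using e spokes'[of x] spokes'[of y] insert_commute[of x y "{}"] by auto
    next
      case False
      \<comment> \<open>A base edge may be a chord of the cycle; extending it by a neighbour
        \<open>z\<close> of \<open>y\<close> makes it opposite to the apex edge at
        \<open>z\<close>.\<close>
      then obtain z where z: "adj y z" "z \<noteq> x" "z \<noteq> a" using ex_neighbour e by metis
      then have "(EdgeP {a, z}, EdgeP {y, x}) \<in> r"
        using base_path_opposite[of z y x] False e(5) adj_sym[of x y] adj_sym[of y z] opp by auto
      moreover have "(?s 0, EdgeP {a, z}) \<in> r" using spokes' z(3) adj_range[OF z(1)] by blast
      ultimately have "(?s 0, EdgeP {y, x}) \<in> r" by (rule trans[rotated])
      then show ?thesis by (simp add: e(1) insert_commute[of x y])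
    qed
  qed
  show ?thesis
  proof clarify
    fix e f assume "e \<in> edges G" "f \<in> edges G"
    then show "(e, f) \<in> r" by (rule trans[OF sym[OF all] all])
  qed
qed

lemma one_ic_colorable_G: "one_ic_colorable n G"
  using one_ic_colorable_if_all_equivalent[OF _ all_equivalent] adj_apex by (auto simp: adj_def)

end

section \<open>Periodic enumeration of a Hamiltonian cycle\<close>

lemma hamiltonian_periodic:
  fixes H :: "('v, 'e) mgraph"
  assumes "hamiltonian H"
  obtains h :: "nat \<Rightarrow> 'v" and k where
    "0 < k" "range h = verts H" "card (verts H) = k"
    "\<And>i j. h i = h j \<longleftrightarrow> i mod k = j mod k"
    "\<And>i. \<exists>e\<in>edges H. ends H e = {h i, h (Suc i)}"
proof -
  obtain ws es where "is_cycle H (ws, es)" and d: "distinct (tl ws)" and vs: "set (tl ws) = verts H"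
    using assms by (auto simp: hamiltonian_def)
  then have len: "length ws = Suc (length es)" and ne: "es \<noteq> []" and es: "set es \<subseteq> edges H"
    and ends: "\<And>i. i < length es \<Longrightarrow> ends H (es ! i) = {ws ! i, ws ! Suc i}"
    and closed: "hd ws = last ws"
    by (auto simp: is_cycle_def is_walk_def)
  define k where "k = length es"
  have k: "0 < k" using ne by (simp add: k_def)
  \<comment> \<open>The head of \<open>ws\<close> is dropped since it recurs as the last vertex;
    this shifts positions by one against \<open>ws\<close>.\<close>
  define h where "h i = tl ws ! (i mod k)" for i
  have ltl: "length (tl ws) = k" by (simp add: k_def len)
  have ws: "ws ! Suc i = tl ws ! i" if "i < k" for i
    using that ltl by (simp add: nth_tl)
  have ws0: "ws ! 0 = ws ! k"
    using closed len last_conv_nth[of ws] hd_conv_nth[of ws] by (cases "ws = []") (auto simp: k_def)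
  have "range h = verts H"
  proof -
    have "range h = (\<lambda>i. tl ws ! i) ` range (\<lambda>i. i mod k)" by (auto simp: h_def)
    also have "range (\<lambda>i. i mod k) = {..<k}"
      using k by (auto simp: image_iff) (metis mod_less)
    finally show ?thesis using vs ltl by (auto simp: set_conv_nth)
  qed
  moreover have "card (verts H) = k" using vs d ltl distinct_card by metis
  moreover have "h i = h j \<longleftrightarrow> i mod k = j mod k" for i j
    unfolding h_def using k by (intro nth_eq_iff_index_eq[OF d]) (simp_all only: ltl mod_less_divisor)
  moreover have "\<exists>e\<in>edges H. ends H e = {h i, h (Suc i)}" for i
  proof -
    \<comment> \<open>Owing to that shift, the edge from \<open>h i\<close> to
      \<open>h (Suc i)\<close> is at position \<open>Suc i mod k\<close> of \<open>es\<close>; the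
      wrap-around case uses \<open>ws0\<close>.\<close>
    let ?m = "Suc i mod k"
    have m: "?m < k" using k by simp
    have "ws ! ?m = h i"
    proof (cases "Suc (i mod k) = k")
      case True
      then have "?m = 0" by (simp add: mod_Suc)
      then show ?thesis using ws0 ws[of "i mod k"] True k by (simp add: h_def)
    next
      case False
      then have "?m = Suc (i mod k)" by (simp add: mod_Suc)
      then show ?thesis using ws[of "i mod k"] k by (simp add: h_def)
    qed
    moreover have "ws ! Suc ?m = h (Suc i)" using ws[OF m] by (simp add: h_def)
    ultimately show ?thesis using ends[of ?m] es m by (intro bexI[of _ "es ! ?m"]) (auto simp: k_def)
  qed
  ultimately show thesis using that k by blast
qed

section \<open>Transport of the cone structure along the isomorphism\<close>

context Kplus_subgraph
begin

text \<open>Injectivity of \<open>\<phi>\<close> identifies the ends of the preimage of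
  \<open>f\<close> with \<open>i\<close> and \<open>j\<close>, and an edge of \<open>K_n^+\<close>
  is determined by its ends.\<close>

lemma adj_of_iso_edge:
  assumes inj: "inj_on \<phi> (verts G)" and \<psi>: "bij_betw \<psi> (edges G) F"
    and ends: "\<forall>e\<in>edges G. ends' (\<psi> e) = \<phi> ` ends G e"
    and f: "f \<in> F" "ends' f = {\<phi> (Vert i), \<phi> (Vert j)}"
    and ij: "i \<in> {1..n}" "j \<in> {1..n}"
  shows "adj i j"
proof -
  obtain e where e: "e \<in> edges G" "f = \<psi> e"
    using \<psi> f(1) by (auto simp: bij_betw_def)
  then obtain x y where xy: "e = EdgeP {x, y}" "adj x y" using edges_G_cases by metis
  have "\<phi> ` {Vert x, Vert y} = \<phi> ` {Vert i, Vert j}"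
    using ends e f(2) ends_G xy by auto
  moreover have "{Vert x, Vert y} \<subseteq> verts G" "{Vert i, Vert j} \<subseteq> verts G"
    using Vert_in_G[OF xy(2)] ij by (auto simp: verts_G Kvertices_def)
  ultimately have "{Vert x, Vert y} = {Vert i, Vert j}"
    using inj inj_on_image_eq_iff by metis
  then show ?thesis using xy(2) adj_sym by (auto simp: doubleton_eq_iff)
qed

lemma Kplus_cone_if_iso_cone:
  fixes H :: "('v, 'e) mgraph"
  assumes "5 \<le> n" "\<not> 3 dvd (n - 1)" "hamiltonian H" "graph_iso G (cone H)"
  shows "\<exists>a h. Kplus_cone n G a (n - 1) h"
proof -
  obtain h' :: "nat \<Rightarrow> 'v" and k where
    "0 < k" and rng: "range h' = verts H" and card: "card (verts H) = k"
    and h'_eq: "\<And>i j. h' i = h' j \<longleftrightarrow> i mod k = j mod k"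
    and cyc: "\<And>i. \<exists>e\<in>edges H. ends H e = {h' i, h' (Suc i)}"
    by (rule hamiltonian_periodic[OF assms(3)]) (rule that)
  have fin: "finite (verts H)" using card \<open>0 < k\<close> card_gt_0_iff by blast
  obtain \<phi> \<psi> where \<phi>: "bij_betw \<phi> (verts G) (verts (cone H))"
    and \<psi>: "bij_betw \<psi> (edges G) (edges (cone H))"
    and ends: "\<forall>e\<in>edges G. ends (cone H) (\<psi> e) = \<phi> ` ends G e"
    using assms(4) by (auto simp: graph_iso_def)
  have vc: "verts (cone H) = insert None (range (\<lambda>i. Some (h' i)))"
    by (auto simp: cone_def rng[symmetric])
  have Kv: "Kvertices n = Vert ` {1..n}" by (auto simp: Kvertices_def)
  have "card (verts G) = n" by (simp add: verts_G Kv card_image inj_on_def)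
  moreover have "card (verts (cone H)) = Suc k"
    using fin card by (simp add: cone_def card_image)
  \<comment> \<open>The isomorphism matches the \<open>n\<close> vertices of \<open>G\<close> with
    the \<open>k\<close> base vertices and the apex.\<close>
  ultimately have k: "k = n - 1" using bij_betw_same_card[OF \<phi>] by simp
  have "bij_betw Vert {1..n} (verts G)"
    by (simp add: verts_G Kv bij_betw_def inj_on_def)
  then have bij: "bij_betw (\<phi> \<circ> Vert) {1..n} (verts (cone H))"
    using \<phi> by (rule bij_betw_trans)
  \<comment> \<open>\<open>p\<close> labels the vertices of the cone by \<open>1..n\<close>; the
    labels of \<open>None\<close> and of the cycle become \<open>a\<close> and
    \<open>h\<close>.\<close>
  define p where "p = inv_into {1..n} (\<phi> \<circ> Vert)"
  have p: "\<phi> (Vert (p v)) = v" "p v \<in> {1..n}" if "v \<in> verts (cone H)" for v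
    using bij_betw_inv_into_right[OF bij that] inv_into_into[of v "\<phi> \<circ> Vert" "{1..n}"]
      that bij_betw_imp_surj_on[OF bij]
    unfolding p_def o_apply by blast+
  have p_bij: "bij_betw p (verts (cone H)) {1..n}"
    unfolding p_def by (rule bij_betw_inv_into[OF bij])
  define a where "a = p None"
  define h where "h i = p (Some (h' i))" for i
  have in_c: "None \<in> verts (cone H)" "Some (h' i) \<in> verts (cone H)" for i
    by (auto simp: vc)
  have adjI: "adj (p u) (p v)"
    if "f \<in> edges (cone H)" "ends (cone H) f = {u, v}" "u \<in> verts (cone H)" "v \<in> verts (cone H)" for f u v
    by (rule adj_of_iso_edge[OF bij_betw_imp_inj_on[OF \<phi>] \<psi> ends that(1)])
      (simp_all only: that p)
  have "Kplus_cone n G a k h"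
  proof (unfold_locales)
    show "4 \<le> k" "\<not> 3 dvd k" using assms k by auto
    show "range h = {1..n} - {a}"
    proof -
      have "verts (cone H) - {None} = range (\<lambda>i. Some (h' i))"
        by (auto simp: vc)
      then have "range h = p ` (verts (cone H) - {None})"
        by (simp add: h_def image_image)
      also have "\<dots> = p ` verts (cone H) - p ` {None}"
        using p_bij in_c by (intro inj_on_image_set_diff[of p "verts (cone H)"]) (auto simp: bij_betw_def)
      finally show ?thesis using p_bij by (simp add: bij_betw_def a_def)
    qed
    show "h i = h j \<longleftrightarrow> i mod k = j mod k" for i j
      using inj_on_eq_iff[OF bij_betw_imp_inj_on[OF p_bij] in_c(2)[of i] in_c(2)[of j]] h'_eq[of i j]
      by (simp add: h_def)
    show "adj a (h i)" for i
      unfolding a_def h_def using in_c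
      by (intro adjI[of "Inr (h' i)"]) (auto simp: cone_def rng[symmetric])
    show "adj (h i) (h (Suc i))" for i
    proof -
      obtain e where "e \<in> edges H" "ends H e = {h' i, h' (Suc i)}" using cyc by blast
      then show ?thesis
        unfolding h_def using in_c by (intro adjI[of "Inl e"]) (auto simp: cone_def)
    qed
  qed
  then show ?thesis using k by blast
qed

end

theorem theorem4p10:
  fixes n :: nat
    and G :: "(cell, cell) mgraph"
    and H :: "('v, 'e) mgraph"
  assumes "n \<ge> 5"
    and "\<not> 3 dvd (n - 1)"
    and "spanning_subgraph G (Kplus n)"
    and "graph H"
    and "hamiltonian H"
    and "graph_iso G (cone H)"
  shows "bypassing n G \<and> one_ic_colorable n G"
proof -
  interpret Kplus_subgraph n G using assms(3) by unfold_locales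
  obtain a h where "Kplus_cone n G a (n - 1) h"
    using Kplus_cone_if_iso_cone[OF assms(1,2,5,6)] by blast
  then interpret Kplus_cone n G a "n - 1" h .
  show ?thesis using bypassing_G one_ic_colorable_G by blast
qed

end
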